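(* Let $n\ge1$ be an integer and let $B$, $C^{[a,b]}$, $p_a$, $q_i$ be as defined in the context. Put $$C=\sum_{a=0}^{n-1}p_aC^{[a,n]}+\sum_{i=0}^{n-2}q_iC^{[i,i+1]},\qquad H=CB+B^\top C^\top .$$ Then the matrix $C$ has zero row sums, and its column-sum vector is $b=(1,\ldots,1,-n)^\top$ (with $n$ entries equal to $1$). The matrix $H$ is diagonal, with $$H_{ii}=\alpha\quad(0\le i<n),\qquad H_{nn}=-n(1+R).$$
   Context: Let $n\ge1$ be an integer, let $r\in(0,1)$ be the unique solution in $(0,1)$ of $r^n(1+n(1+r))=1$, and put $h=1+r$, $\alpha=1-r$, $R=1+nh=r^{-n}$. Matrices are real $(n+1)\times(n+1)$, indexed by $\{0,1,\ldots,n\}$. The trajectory matrix $B$ is lower triangular with $B_{ij}=h$ if $j<i$, $B_{ii}=1$, and $B_{ij}=0$ if $j>i$. For integers $0\le a<b\le n$, the interval mode $C^{[a,b]}$ is defined as follows: put $\ell=b-a$, and for a row $i\in[a,b]$ write $s=i-a$. Then $$C^{[a,b]}_{ij}=\begin{cases}h(s+1)-1,&a\le i<j\le b,\\ 1+h(\ell-s),&a\le j<i\le b,\\ -\bigl[(\ell-s)(h(s+1)-1)+s(1+h(\ell-s))\bigr],&i=j\in[a,b],\\ 0,&\text{otherwise.}\end{cases}$$ For integers $s,t\ge 0$ put $\sigma(s,t)=(s+1)t\left[\alpha+\frac h2(t-s-1)\right]$. For $i=0,\ldots,n-2$ set $$\mathsf Z_i=\frac{2hi+3+r-\alpha r^{-2i-2}}{h^2},\qquad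 \mathsf Y_i=\frac{\mathsf Z_i}{n-i},\qquad \mathsf W_i=\mathsf Y_i-3\mathsf Y_{i-1}+3\mathsf Y_{i-2}-\mathsf Y_{i-3},$$ where $\mathsf Y_j=0$ for $j<0$. With $p_{-1}=0$, define the suffix weights recursively by $$p_i=\frac{\mathsf W_i+(n-i+4)p_{i-1}}{n-i-1},\qquad i=0,\ldots,n-2,$$ the adjacent weights by $$q_i=\frac{1}{\alpha}\Bigl(i+1-\sum_{a=0}^{i}p_a\,\sigma(i-a,n-i)\Bigr),\qquad i=0,\ldots,n-2,$$ and the final suffix weight by $$p_{n-1}=\frac1\alpha\Bigl(n-\sum_{a=0}^{n-2}p_a(n-a)\left[\alpha-\frac h2(n-1-a)\right]\Bigr).$$ Empty ranges have their usual meaning: for $n=1$ there are no $q_i$, and $p_0=1/\alpha$. *)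

theory Defs
  imports Complex_Main "Jordan_Normal_Form.Matrix"
begin

definition par_r :: "nat \<Rightarrow> real" where
  "par_r n = (THE r. 0 < r \<and> r < 1 \<and> r ^ n * (1 + real n * (1 + r)) = 1)"

text \<open>The description above denotes for every \<open>n \<ge> 1\<close>.\<close>

lemma par_r_ex1:
  assumes "n \<ge> 1"
  shows "\<exists>!r::real. 0 < r \<and> r < 1 \<and> r ^ n * (1 + real n * (1 + r)) = 1"
proof -
  define f :: "real \<Rightarrow> real" where "f = (\<lambda>r. r ^ n * (1 + real n * (1 + r)))"
  have f0: "f 0 = 0" and f1: "f 1 > 1"
    using assms by (simp_all add: f_def power_0_left)
  have "\<exists>r\<ge>0. r \<le> 1 \<and> f r = 1"
  proof (rule IVT')
    show "continuous_on {0..1} f" unfolding f_def by (intro continuous_intros)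
  qed (use f0 f1 in auto)
  then obtain r where r: "0 \<le> r" "r \<le> 1" "f r = 1" by blast
  have "r \<noteq> 0" "r \<noteq> 1" using f0 f1 r(3) by auto
  with r have ex: "0 < r \<and> r < 1 \<and> f r = 1" by auto
  have mono: "f x < f y" if "0 < x" "x < y" for x y
    unfolding f_def
  proof (rule mult_strict_mono)
    show "x ^ n < y ^ n" using that assms by (intro power_strict_mono) auto
    show "1 + real n * (1 + x) < 1 + real n * (1 + y)" using that assms by simp
  qed (use that in auto)
  have "\<exists>!r. 0 < r \<and> r < 1 \<and> f r = 1"
  proof (rule ex1I[of _ r])
    show "0 < r \<and> r < 1 \<and> f r = 1" by (fact ex)
  next
    fix s assume s: "0 < s \<and> s < 1 \<and> f s = 1"
    show "s = r" using mono[of s r] mono[of r s] s ex by (cases s r rule: linorder_cases) auto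
  qed
  then show ?thesis by (simp add: f_def)
qed

definition par_h :: "nat \<Rightarrow> real" where
  "par_h n = 1 + par_r n"

definition par_alpha :: "nat \<Rightarrow> real" where
  "par_alpha n = 1 - par_r n"

definition par_R :: "nat \<Rightarrow> real" where
  "par_R n = 1 + real n * par_h n"

definition trajectory_mat :: "nat \<Rightarrow> real mat" where
  "trajectory_mat n = mat (n + 1) (n + 1) (\<lambda>(i, j).
     if j < i then par_h n else if j = i then 1 else 0)"

definition interval_mode :: "nat \<Rightarrow> nat \<Rightarrow> nat \<Rightarrow> real mat" where
  "interval_mode n a b = mat (n + 1) (n + 1) (\<lambda>(i, j).
     let h = par_h n; l = real b - real a; s = real i - real a in
     if a \<le> i \<and> i < j \<and> j \<le> b then h * (s + 1) - 1
     else if a \<le> j \<and> j < i \<and> i \<le> b then 1 + h * (l - s)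
     else if i = j \<and> a \<le> i \<and> i \<le> b
       then - ((l - s) * (h * (s + 1) - 1) + s * (1 + h * (l - s)))
     else 0)"

definition sigma_fun :: "nat \<Rightarrow> nat \<Rightarrow> nat \<Rightarrow> real" where
  "sigma_fun n s t =
     (real s + 1) * real t * (par_alpha n + par_h n / 2 * (real t - real s - 1))"

definition Z_seq :: "nat \<Rightarrow> nat \<Rightarrow> real" where
  "Z_seq n i =
     (2 * par_h n * real i + 3 + par_r n - par_alpha n * par_r n powi (- 2 * int i - 2))
       / (par_h n)\<^sup>2"

definition Y_seq :: "nat \<Rightarrow> int \<Rightarrow> real" where
  "Y_seq n i = (if i < 0 then 0 else Z_seq n (nat i) / (real n - real_of_int i))"

definition W_seq :: "nat \<Rightarrow> nat \<Rightarrow> real" where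
  "W_seq n i = Y_seq n (int i) - 3 * Y_seq n (int i - 1)
     + 3 * Y_seq n (int i - 2) - Y_seq n (int i - 3)"

text \<open>
  \<open>suffix_rec n i\<close> is \<open>p\<^sub>i\<close> for \<open>i \<le> n - 2\<close>; the first equation incorporates \<open>p\<^sub>-\<^sub>1 = 0\<close>.
  The last weight \<open>p\<^sub>n\<^sub>-\<^sub>1\<close> has its own formula, added in \<open>suffix_weight\<close>.
  Values at larger indices are irrelevant.
\<close>

primrec suffix_rec :: "nat \<Rightarrow> nat \<Rightarrow> real" where
  "suffix_rec n 0 = W_seq n 0 / (real n - 1)"
| "suffix_rec n (Suc i) =
     (W_seq n (Suc i) + (real n - real (Suc i) + 4) * suffix_rec n i)
       / (real n - real (Suc i) - 1)"

definition suffix_weight :: "nat \<Rightarrow> nat \<Rightarrow> real" where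
  "suffix_weight n i =
     (if Suc i = n
      then 1 / par_alpha n *
        (real n - (\<Sum>a<n - 1. suffix_rec n a * (real n - real a) *
           (par_alpha n - par_h n / 2 * (real n - 1 - real a))))
      else suffix_rec n i)"

definition adjacent_weight :: "nat \<Rightarrow> nat \<Rightarrow> real" where
  "adjacent_weight n i =
     1 / par_alpha n *
       (real i + 1 - (\<Sum>a\<le>i. suffix_weight n a * sigma_fun n (i - a) (n - i)))"

text \<open>
  The linear combination of interval modes is taken entrywise, since dimension-indexed
  matrices form no additive monoid type. For \<open>n \<ge> 1\<close> the sets \<open>{..<n}\<close> and \<open>{..<n - 1}\<close>
  are the ranges \<open>0, \<dots>, n - 1\<close> and \<open>0, \<dots>, n - 2\<close>.
\<close>

definition C_mat :: "nat \<Rightarrow> real mat" where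
  "C_mat n = mat (n + 1) (n + 1) (\<lambda>(i, j).
     (\<Sum>a<n. suffix_weight n a * interval_mode n a n $$ (i, j))
     + (\<Sum>k<n - 1. adjacent_weight n k * interval_mode n k (k + 1) $$ (i, j)))"

definition H_mat :: "nat \<Rightarrow> real mat" where
  "H_mat n = C_mat n * trajectory_mat n
     + transpose_mat (trajectory_mat n) * transpose_mat (C_mat n)"

definition row_sums :: "real mat \<Rightarrow> real vec" where
  "row_sums A = vec (dim_row A) (\<lambda>i. \<Sum>j<dim_col A. A $$ (i, j))"

definition col_sums :: "real mat \<Rightarrow> real vec" where
  "col_sums A = vec (dim_col A) (\<lambda>j. \<Sum>i<dim_row A. A $$ (i, j))"

definition b_vec :: "nat \<Rightarrow> real vec" where
  "b_vec n = vec (n + 1) (\<lambda>j. if j < n then 1 else - real n)"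

end

theory Submission
  imports Defs
begin

text \<open>
  Every interval mode has zero row sums, and for it the off-diagonal part of \<open>CB\<close> is antisymmetric.
  Hence only the column sums and the diagonal of \<open>H\<close> depend on the weights. The partial column sums
  of the mode on \<open>[a,n]\<close> are \<open>\<sigma>(j-a,n-j)\<close> and those of an adjacent mode are \<open>\<alpha>\<close> at one place, so
  the choice of \<open>q\<^sub>i\<close> and \<open>p\<^sub>n\<^sub>-\<^sub>1\<close> amounts to the column-sum condition. After elimination of the \<open>q\<^sub>i\<close>,
  the diagonal of \<open>H\<close> depends only on the moments \<open>M\<^sub>i = \<Sum>\<^sub>a p\<^sub>a F(i-a,n-i)\<close> with
  \<open>F(s,t) = (s+1)t(t-s-1)\<close>: the condition \<open>H\<^sub>i\<^sub>i = \<alpha>\<close> becomes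
  \<open>h M\<^sub>i\<^sub>-\<^sub>1 - h r\<^sup>2 M\<^sub>i = \<alpha>\<^sup>2 + 2i - 2r\<^sup>2(i+1)\<close>, whose solution is \<open>Z\<^sub>i\<close>. The recursion for \<open>p\<^sub>i\<close> says
  \<open>M\<^sub>i = Z\<^sub>i\<close> for \<open>i \<le> n - 2\<close>, because its third differences are those of \<open>M\<^sub>i/(n-i)\<close>. The antisymmetry
  \<open>F(t-1,s+1) = -F(s,t)\<close> gives \<open>\<Sum>\<^sub>i M\<^sub>i = 0 = \<Sum>\<^sub>i Z\<^sub>i\<close>, hence also \<open>M\<^sub>n\<^sub>-\<^sub>1 = Z\<^sub>n\<^sub>-\<^sub>1\<close>, which yields
  the last two diagonal entries.
\<close>

section \<open>Entries and partial sums of one interval mode\<close>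

text \<open>Here \<open>h\<close> is a free real and the indices are unbounded, so the identities
  for one mode are polynomial and independent of the equation for r.\<close>

definition mode_entry :: "real \<Rightarrow> nat \<Rightarrow> nat \<Rightarrow> nat \<Rightarrow> nat \<Rightarrow> real" where
  "mode_entry h a b i j =
    (if a \<le> i \<and> i < j \<and> j \<le> b then h * (real i - real a + 1) - 1
     else if a \<le> j \<and> j < i \<and> i \<le> b then 1 + h * (real b - real i)
     else if i = j \<and> a \<le> i \<and> i \<le> b
       then - ((real b - real i) * (h * (real i - real a + 1) - 1)
               + (real i - real a) * (1 + h * (real b - real i)))
     else 0)"

lemma interval_mode_entry:
  assumes "i \<le> n" "j \<le> n"
  shows "interval_mode n a b $$ (i, j) = mode_entry (par_h n) a b i j"
  using assms by (simp add: interval_mode_def mode_entry_def Let_def)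

text \<open>A row is constant on either side of its diagonal entry, which cancels the rest of the
  row. Beyond the diagonal the partial sum is therefore minus the entries still to come.\<close>

lemma mode_row_partial_sum:
  assumes "a < b"
  shows "(\<Sum>k<m. mode_entry h a b i k) =
    (if i < a \<or> b < i \<or> m \<le> a \<or> b < m then 0
     else if m \<le> i then (real m - real a) * (1 + h * (real b - real i))
     else - (real b + 1 - real m) * (h * (real i - real a + 1) - 1))"
proof (cases "a \<le> i \<and> i \<le> b")
  case False
  then show ?thesis by (auto simp: mode_entry_def intro!: sum.neutral)
next
  case True
  then have ab: "a \<le> i" "i \<le> b" by auto
  show ?thesis
  proof (induction m)
    case 0
    then show ?case by simp
  next
    case (Suc m)
    consider "m < a" | "a = m" "m < i" | "a < m" "m < i" | "m = i" | "i < m" "m < b"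
      | "i < m" "m = b" | "b < m"
      by linarith
    then show ?case
    proof cases
      case 4
      then consider "i = a" "i < b" | "a < i" "i < b" | "a < i" "i = b" using ab assms by linarith
      then show ?thesis
        unfolding sum.lessThan_Suc Suc.IH
        using 4 by cases (auto simp: mode_entry_def, simp_all add: algebra_simps)
    qed (unfold sum.lessThan_Suc Suc.IH, use ab in \<open>simp_all add: mode_entry_def\<close>, simp_all add: algebra_simps)
  qed
qed

text \<open>This is \<sigma> with \<alpha> = 2 - h, on real arguments so that it can be taken at s =
  -1, where it vanishes.\<close>

definition mode_flux :: "real \<Rightarrow> real \<Rightarrow> real \<Rightarrow> real" where
  "mode_flux h s t = (s + 1) * t * ((2 - h) + h / 2 * (t - s - 1))"

text \<open>Above and below the diagonal the entries form arithmetic progressions. The full column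
  sum is a difference of \<sigma> at neighbouring columns, so sums over columns telescope.\<close>

lemma mode_column_partial_sum:
  assumes "a < b" "a \<le> j" "j \<le> b"
  shows "(\<Sum>i<m. mode_entry h a b i j) =
    (if m \<le> a then 0
     else if m \<le> j then h * (real m - real a) * (real m - real a + 1) / 2 - (real m - real a)
     else mode_flux h (real j - real a) (real b - real j)
       - mode_flux h (real j - real a - 1) (real b - real j + 1)
       - (if m \<le> b then (real b + 1 - real m) + h * (real b - real m) * (real b - real m + 1) / 2 else 0))"
proof (induction m)
  case 0
  then show ?case by simp
next
  case (Suc m)
  consider "m < a" | "a \<le> m" "m < j"
    | "m = j" "j < b" | "m = j" "j = b" | "j < m" "m < b" | "j < m" "m = b" | "b < m"
    using assms by linarith
  then show ?case
    using assms unfolding sum.lessThan_Suc Suc.IH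
    by cases (auto simp: mode_entry_def mode_flux_def field_simps)
qed

section \<open>One mode times the trajectory matrix\<close>

lemma sum_times_trajectory:
  fixes f :: "nat \<Rightarrow> real"
  assumes "j \<le> n"
  shows "(\<Sum>k<Suc n. f k * (if j < k then h else if j = k then 1 else 0))
    = f j + h * (sum f {..<Suc n} - sum f {..<Suc j})"
  using assms
proof (induction n)
  case 0
  then show ?case by simp
next
  case (Suc n)
  show ?case
  proof (cases "j = Suc n")
    case True
    then show ?thesis by (simp del: sum.lessThan_Suc add: sum.lessThan_Suc[of _ "Suc n"])
  next
    case False
    then have "j \<le> n" using Suc.prems by simp
    from Suc.IH[OF this] this show ?thesis
      by (simp add: algebra_simps)
  qed
qed

definition mode_trajectory :: "real \<Rightarrow> nat \<Rightarrow> nat \<Rightarrow> nat \<Rightarrow> nat \<Rightarrow> nat \<Rightarrow> real" where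
  "mode_trajectory h n a b i j =
    (\<Sum>k<Suc n. mode_entry h a b i k * (if j < k then h else if j = k then 1 else 0))"

lemma mode_trajectory_eq:
  assumes "a < b" "b \<le> n" "j \<le> n"
  shows "mode_trajectory h n a b i j =
    mode_entry h a b i j - h * (\<Sum>k<Suc j. mode_entry h a b i k)"
proof -
  have "(\<Sum>k<Suc n. mode_entry h a b i k) = 0"
    using assms by (subst mode_row_partial_sum) auto
  then show ?thesis
    unfolding mode_trajectory_def sum_times_trajectory[OF assms(3)]
    by (simp del: sum.lessThan_Suc)
qed

text \<open>For i < j inside the interval the two terms are plus and minus the same product
  (h(i-a+1) - 1)(1 + h(b-j)), of the entry of row i right of its diagonal and that of row j left of
  its diagonal.\<close>

lemma mode_trajectory_antisym_less:
  assumes "a < b" "b \<le> n" "j \<le> n" "i < j"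
  shows "mode_trajectory h n a b i j + mode_trajectory h n a b j i = 0"
proof -
  have i: "i \<le> n" using assms by simp
  consider "i < a" | "b < i" | "a \<le> i" "i \<le> b" "j < b" | "a \<le> i" "j = b" | "i \<le> b" "b < j"
    by linarith
  then show ?thesis
    using assms
    unfolding mode_trajectory_eq[OF assms(1,2,3)] mode_trajectory_eq[OF assms(1,2) i]
      mode_row_partial_sum[OF assms(1)]
    by cases (auto simp: mode_entry_def algebra_simps)
qed

lemma mode_trajectory_antisym:
  assumes "a < b" "b \<le> n" "i \<le> n" "j \<le> n" "i \<noteq> j"
  shows "mode_trajectory h n a b i j + mode_trajectory h n a b j i = 0"
  using mode_trajectory_antisym_less[of a b n j i h] mode_trajectory_antisym_less[of a b n i j h] assms
  by (cases i j rule: linorder_cases) (auto simp: add.commute)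

definition mode_energy :: "real \<Rightarrow> real \<Rightarrow> real \<Rightarrow> real" where
  "mode_energy h s t = (h - 1) * t * (h * (s + 1) - 1) - s * (1 + h * t)"

lemma mode_trajectory_diag:
  assumes "a < b" "b \<le> n" "i \<le> n"
  shows "mode_trajectory h n a b i i =
    (if a \<le> i \<and> i \<le> b then mode_energy h (real i - real a) (real b - real i) else 0)"
proof -
  consider "i < a \<or> b < i" | "a \<le> i" "i < b" | "a \<le> i" "i = b" by linarith
  then show ?thesis
    using assms
    unfolding mode_trajectory_eq[OF assms] mode_row_partial_sum[OF assms(1)]
    by cases (auto simp: mode_entry_def mode_energy_def algebra_simps)
qed

section \<open>Moments of the suffix weights\<close>

definition moment_kernel :: "real \<Rightarrow> real \<Rightarrow> real" where
  "moment_kernel s t = (s + 1) * t * (t - s - 1)"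

definition moment :: "nat \<Rightarrow> (nat \<Rightarrow> real) \<Rightarrow> nat \<Rightarrow> real" where
  "moment n p i = (\<Sum>a\<le>i. p a * moment_kernel (real i - real a) (real n - real i))"

lemma W_seq_eq_suffix_rec:
  assumes "Suc i < n"
  shows "W_seq n i = (real n - real i - 1) * suffix_rec n i
    - (if i = 0 then 0 else (real n - real i + 4) * suffix_rec n (i - 1))"
proof -
  have "real n - real i - 1 \<noteq> 0" using assms by linarith
  then have cancel: "(real n - real i - 1) * (x / (real n - real i - 1)) = x" for x
    by simp
  show ?thesis
  proof (cases i)
    case 0
    then show ?thesis using cancel[of "W_seq n 0"] by simp
  next
    case (Suc k)
    then show ?thesis
      using cancel[of "W_seq n (Suc k) + (real n - real (Suc k) + 4) * suffix_rec n k"] by simp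
  qed
qed

text \<open>The kernel divided by n - i is quadratic in i with second difference -4. Hence the third
  difference of the right-hand side is (n-i-1) p_i - (n-i+4) p_(i-1), which is \<open>W_seq\<close>
  by the recursion. The induction carries all three orders to integrate this three times;
  \<open>Y_seq\<close> being 0 at negative indices supplies the initial values.\<close>

lemma Y_seq_eq:
  assumes "Suc i < n"
  shows "Y_seq n (int i) =
      (\<Sum>a\<le>i. suffix_rec n a * ((real i - real a + 1) * (real n - real a - 1 - 2 * (real i - real a))))
    \<and> Y_seq n (int i) - Y_seq n (int i - 1) =
      (\<Sum>a\<le>i. suffix_rec n a * (real n - real a - 1 - 4 * (real i - real a)))
    \<and> Y_seq n (int i) - 2 * Y_seq n (int i - 1) + Y_seq n (int i - 2) =
      suffix_rec n i * (real n - real i - 1) - 4 * (\<Sum>a<i. suffix_rec n a)"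
  using assms
proof (induction i)
  case 0
  then show ?case
    using W_seq_eq_suffix_rec[of 0 n] by (simp add: W_seq_def Y_seq_def mult.commute del: suffix_rec.simps)
next
  case (Suc i)
  note [simp del] = suffix_rec.simps
  have IH: "Y_seq n (int i) =
      (\<Sum>a\<le>i. suffix_rec n a * ((real i - real a + 1) * (real n - real a - 1 - 2 * (real i - real a))))"
    "Y_seq n (int i) - Y_seq n (int i - 1) =
      (\<Sum>a\<le>i. suffix_rec n a * (real n - real a - 1 - 4 * (real i - real a)))"
    "Y_seq n (int i) - 2 * Y_seq n (int i - 1) + Y_seq n (int i - 2) =
      suffix_rec n i * (real n - real i - 1) - 4 * (\<Sum>a<i. suffix_rec n a)"
    using Suc by auto
  have W: "W_seq n (Suc i) = (real n - real (Suc i) - 1) * suffix_rec n (Suc i)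
      - (real n - real (Suc i) + 4) * suffix_rec n i"
    using W_seq_eq_suffix_rec[of "Suc i" n] Suc.prems by simp
  have S: "int (Suc i) - 1 = int i" "int (Suc i) - 2 = int i - 1" "int (Suc i) - 3 = int i - 2"
    by auto
  have third: "Y_seq n (int (Suc i)) - 2 * Y_seq n (int i) + Y_seq n (int i - 1) =
      suffix_rec n (Suc i) * (real n - real (Suc i) - 1) - 4 * (\<Sum>a<Suc i. suffix_rec n a)"
    using W IH(3) unfolding W_seq_def S by (simp add: algebra_simps)
  have second: "Y_seq n (int (Suc i)) - Y_seq n (int i) =
      (\<Sum>a\<le>Suc i. suffix_rec n a * (real n - real a - 1 - 4 * (real (Suc i) - real a)))"
  proof -
    have "(\<Sum>a\<le>i. suffix_rec n a * (real n - real a - 1 - 4 * (real (Suc i) - real a)))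
      = (\<Sum>a\<le>i. suffix_rec n a * (real n - real a - 1 - 4 * (real i - real a)))
        - 4 * (\<Sum>a\<le>i. suffix_rec n a)"
      unfolding sum_distrib_left sum_subtractf[symmetric]
      by (rule sum.cong) (simp_all add: algebra_simps)
    then show ?thesis
      using third IH(2) by (simp add: lessThan_Suc_atMost algebra_simps del: of_nat_Suc sum.lessThan_Suc)
  qed
  have first: "Y_seq n (int (Suc i)) =
      (\<Sum>a\<le>Suc i. suffix_rec n a *
        ((real (Suc i) - real a + 1) * (real n - real a - 1 - 2 * (real (Suc i) - real a))))"
  proof -
    have "(\<Sum>a\<le>i. suffix_rec n a *
        ((real (Suc i) - real a + 1) * (real n - real a - 1 - 2 * (real (Suc i) - real a))))
      = (\<Sum>a\<le>i. suffix_rec n a * ((real i - real a + 1) * (real n - real a - 1 - 2 * (real i - real a))))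
       + (\<Sum>a\<le>i. suffix_rec n a * (real n - real a - 1 - 4 * (real (Suc i) - real a)))"
      unfolding sum.distrib[symmetric]
      by (rule sum.cong) (simp_all add: algebra_simps)
    then show ?thesis
      using second IH(1) by (simp del: of_nat_Suc)
  qed
  show ?case using first second third unfolding S by blast
qed

lemma moment_suffix_rec:
  assumes "Suc i < n"
  shows "moment n (suffix_rec n) i = Z_seq n i"
proof -
  have "real n - real i \<noteq> 0" using assms by linarith
  then have "Z_seq n i = (real n - real i) * Y_seq n (int i)"
    by (simp add: Y_seq_def)
  also have "\<dots> = moment n (suffix_rec n) i"
    unfolding moment_def moment_kernel_def using Y_seq_eq[OF assms]
    by (simp add: sum_distrib_left algebra_simps del: suffix_rec.simps)
  finally show ?thesis by simp
qed

text \<open>The fraction is a discrete antiderivative in m of the kernel. It vanishes at m = a,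
  where the weight \<open>p a\<close> enters, and at m = n.\<close>

lemma sum_moment_partial:
  "(\<Sum>i<m. moment n p i) =
    (\<Sum>a<m. p a * ((real m - real a) * (real m - real a + 1) * (real n - real m) * (real n - real m + 1) / 2))"
proof (induction m)
  case 0
  then show ?case by simp
next
  case (Suc m)
  have "(\<Sum>a\<le>m. p a * ((real (Suc m) - real a) * (real (Suc m) - real a + 1) * (real n - real (Suc m)) * (real n - real (Suc m) + 1) / 2))
    = (\<Sum>a\<le>m. p a * ((real m - real a) * (real m - real a + 1) * (real n - real m) * (real n - real m + 1) / 2)) + moment n p m"
    unfolding moment_def moment_kernel_def sum.distrib[symmetric]
    by (rule sum.cong) (simp_all add: field_simps)
  then show ?case
    using Suc.IH by (simp add: lessThan_Suc_atMost[symmetric] )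
qed

text \<open>
  This is why \<open>moment_suffix_weight\<close> below extends from \<open>i \<le> n - 2\<close>, where it encodes the recursion
  for \<open>p\<close>, to \<open>i = n - 1\<close>: the numbers \<open>Z\<^sub>i\<close> sum to zero as well, by the equation for \<open>r\<close>.
\<close>

lemma sum_moment_eq_0: "(\<Sum>i<n. moment n p i) = 0"
  by (simp add: sum_moment_partial)

section \<open>The root r and the numbers Z_i\<close>

lemma par_r:
  assumes "n \<ge> 1"
  shows "0 < par_r n" "par_r n < 1" "par_r n ^ n * par_R n = 1"
  using theI'[OF par_r_ex1[OF assms]] by (simp_all add: par_r_def[symmetric] par_R_def par_h_def)

lemma Z_seq_eq:
  assumes "n \<ge> 1"
  shows "Z_seq n i = (2 * par_h n * real i + 3 + par_r n - par_alpha n * (1 / (par_r n)\<^sup>2) ^ Suc i) / (par_h n)\<^sup>2"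
proof -
  have "- 2 * int i - 2 = - int (2 * Suc i)" by simp
  then have "par_r n powi (- 2 * int i - 2) = (1 / (par_r n)\<^sup>2) ^ Suc i"
    by (simp only: power_int_minus power_int_of_nat power_mult power_divide power_one) (simp add: divide_simps)
  then show ?thesis unfolding Z_seq_def by simp
qed

text \<open>An arithmetic plus a geometric series; the factor \<alpha> of the latter becomes 1/h
  because h \<alpha> = 1 - r^2.\<close>

lemma sum_Z_seq_partial:
  assumes "n \<ge> 1"
  shows "(\<Sum>i<m. Z_seq n i) =
    (par_h n * real m * (real m - 1) + (3 + par_r n) * real m - ((1 / (par_r n)\<^sup>2) ^ m - 1) / par_h n) / (par_h n)\<^sup>2"
proof (induction m)
  case 0
  then show ?case by simp
next
  case (Suc m)
  define u where "u = (1 / (par_r n)\<^sup>2) ^ m"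
  define v where "v = (1 / (par_r n)\<^sup>2) ^ Suc m"
  have r: "par_r n \<noteq> 0" "par_h n \<noteq> 0" using par_r[OF assms] by (auto simp: par_h_def)
  have u: "u = v - par_h n * par_alpha n * v"
    using r(1) by (simp add: u_def v_def par_h_def par_alpha_def field_simps power2_eq_square)
  have "(u - 1) / par_h n + par_alpha n * v = (v - 1) / par_h n"
    unfolding u using r(2) by (simp add: field_simps)
  then show ?case
    unfolding sum.lessThan_Suc Suc.IH Z_seq_eq[OF assms, of m] add_divide_distrib[symmetric]
      u_def[symmetric] v_def[symmetric]
    by (intro arg_cong2[where f = "(/)"] refl) (simp add: algebra_simps)
qed

lemma inverse_square_power:
  assumes "n \<ge> 1"
  shows "(1 / (par_r n)\<^sup>2) ^ n = (par_R n)\<^sup>2"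
proof -
  have "1 / par_r n ^ n = par_R n" using par_r[OF assms] by (simp add: field_simps)
  then show ?thesis
    by (metis power_divide power_one power_mult mult.commute)
qed

text \<open>Since R - 1 = n h, the geometric part (R^2 - 1)/h equals n(2 + n h), which cancels the
  arithmetic part.\<close>

lemma sum_Z_seq_eq_0:
  assumes "n \<ge> 1"
  shows "(\<Sum>i<n. Z_seq n i) = 0"
proof -
  have "par_h n \<noteq> 0" using par_r[OF assms] by (simp add: par_h_def)
  then show ?thesis
    unfolding sum_Z_seq_partial[OF assms] inverse_square_power[OF assms]
    by (simp add: par_R_def field_simps power2_eq_square) (simp add: par_h_def algebra_simps)
qed

lemma moment_suffix_weight:
  assumes "i < n"
  shows "moment n (suffix_weight n) i = Z_seq n i"
proof -
  have early: "moment n (suffix_weight n) i = Z_seq n i" if "Suc i < n" for i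
  proof -
    have "moment n (suffix_weight n) i = moment n (suffix_rec n) i"
      unfolding moment_def using that by (intro sum.cong) (auto simp: suffix_weight_def)
    then show ?thesis using moment_suffix_rec[OF that] by simp
  qed
  show ?thesis
  proof (cases "Suc i < n")
    case True
    then show ?thesis by (rule early)
  next
    case False
    then have n: "n = Suc i" using assms by simp
    have "(\<Sum>k<i. moment n (suffix_weight n) k) = (\<Sum>k<i. Z_seq n k)"
      using n by (intro sum.cong early) auto
    moreover have "(\<Sum>k<Suc i. moment n (suffix_weight n) k) = (\<Sum>k<Suc i. Z_seq n k)"
      using sum_moment_eq_0[of n] sum_Z_seq_eq_0[of n] n by simp
    ultimately show ?thesis by simp
  qed
qed

text \<open>The powers of r cancel in the weighted difference, leaving an affine function of i. The
  value 0 for index -1 agrees with the closed formula, whose numerator there is -2h + 3 + r -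
  \<alpha> = 0.\<close>

lemma Z_seq_recurrence:
  assumes "n \<ge> 1"
  shows "par_h n * (if i = 0 then 0 else Z_seq n (i - 1)) - par_h n * (par_r n)\<^sup>2 * Z_seq n i
    = (par_alpha n)\<^sup>2 + 2 * real i - 2 * (par_r n)\<^sup>2 * (real i + 1)"
proof -
  have r: "par_r n \<noteq> 0" "par_h n \<noteq> 0" using par_r[OF assms] by (auto simp: par_h_def)
  define X where "X i = 2 * par_h n * real i + 3 + par_r n - par_alpha n * (1 / (par_r n)\<^sup>2) ^ Suc i" for i
  have Z: "Z_seq n i = X i / (par_h n)\<^sup>2" for i
    by (simp only: X_def Z_seq_eq[OF assms])
  have "(if i = 0 then 0 else X (i - 1)) - (par_r n)\<^sup>2 * X i
    = par_h n * ((par_alpha n)\<^sup>2 + 2 * real i - 2 * (par_r n)\<^sup>2 * (real i + 1))"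
  proof (cases i)
    case 0
    have "(par_r n)\<^sup>2 * X 0 = (par_r n)\<^sup>2 * (3 + par_r n) - par_alpha n"
      using r by (simp add: X_def right_diff_distrib)
    then show ?thesis using 0
      by (simp add: par_h_def par_alpha_def algebra_simps power2_eq_square)
  next
    case (Suc k)
    define u where "u = (1 / (par_r n)\<^sup>2) ^ Suc k"
    define v where "v = (1 / (par_r n)\<^sup>2) ^ Suc (Suc k)"
    have v: "(par_r n)\<^sup>2 * v = u"
      unfolding v_def power_Suc[of _ "Suc k"] u_def[symmetric] using r by simp
    have "X (Suc k) = 2 * par_h n * real (Suc k) + 3 + par_r n - par_alpha n * v"
      by (simp only: X_def v_def)
    then have "(par_r n)\<^sup>2 * X (Suc k)
      = (par_r n)\<^sup>2 * (2 * par_h n * real (Suc k) + 3 + par_r n) - par_alpha n * u"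
      unfolding v[symmetric] by (simp only: right_diff_distrib mult.left_commute[of _ "par_alpha n"])
    moreover have "X k = 2 * par_h n * real k + 3 + par_r n - par_alpha n * u"
      by (simp only: X_def u_def)
    ultimately show ?thesis using Suc
      by (simp add: par_h_def par_alpha_def algebra_simps power2_eq_square)
  qed
  then have "((if i = 0 then 0 else X (i - 1)) - (par_r n)\<^sup>2 * X i) / par_h n
    = (par_alpha n)\<^sup>2 + 2 * real i - 2 * (par_r n)\<^sup>2 * (real i + 1)"
    using r by simp
  moreover have "((if i = 0 then 0 else X (i - 1)) - (par_r n)\<^sup>2 * X i) / par_h n
    = par_h n * (if i = 0 then 0 else Z_seq n (i - 1)) - par_h n * (par_r n)\<^sup>2 * Z_seq n i"
    unfolding Z using r by (simp add: field_simps power2_eq_square)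
  ultimately show ?thesis by simp
qed

lemma par_alpha_h: "par_alpha n = 2 - par_h n"
  by (simp add: par_alpha_def par_h_def)

section \<open>Weighted combinations of modes\<close>

text \<open>\<open>E a b\<close> is any quantity attached to the interval [a,b]. By linearity the
  entries and sums of C and H are all of this form, so facts about one mode transfer to
  them.\<close>

definition mode_combination :: "nat \<Rightarrow> (nat \<Rightarrow> nat \<Rightarrow> real) \<Rightarrow> real" where
  "mode_combination n E = (\<Sum>a<n. suffix_weight n a * E a n)
    + (\<Sum>k<n - 1. adjacent_weight n k * E k (k + 1))"

lemma mode_combination_cong:
  assumes "\<And>a b. a < b \<Longrightarrow> b \<le> n \<Longrightarrow> E a b = E' a b"
  shows "mode_combination n E = mode_combination n E'"
  unfolding mode_combination_def by (intro arg_cong2[where f = "(+)"] sum.cong) (auto simp: assms)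

lemma mode_combination_add:
  "mode_combination n E + mode_combination n E' = mode_combination n (\<lambda>a b. E a b + E' a b)"
  by (simp add: mode_combination_def sum.distrib algebra_simps)

lemma mode_combination_sum:
  "(\<Sum>x\<in>X. mode_combination n (E x) * w x) = mode_combination n (\<lambda>a b. \<Sum>x\<in>X. E x a b * w x)"
proof -
  have "(\<Sum>x\<in>X. (\<Sum>a\<in>A. v a * G x a) * w x) = (\<Sum>a\<in>A. v a * (\<Sum>x\<in>X. G x a * w x))"
    for A :: "nat set" and v :: "nat \<Rightarrow> real" and G
    unfolding sum_distrib_left sum_distrib_right by (subst sum.swap) (simp add: mult.assoc)
  then show ?thesis by (simp only: mode_combination_def distrib_right sum.distrib)
qed

lemma C_mat_entry:
  assumes "i \<le> n" "j \<le> n"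
  shows "C_mat n $$ (i, j) = mode_combination n (\<lambda>a b. mode_entry (par_h n) a b i j)"
  using assms by (simp add: C_mat_def mode_combination_def interval_mode_entry)

lemma H_mat_entry:
  assumes "i \<le> n" "j \<le> n"
  shows "H_mat n $$ (i, j) = mode_combination n (\<lambda>a b.
    mode_trajectory (par_h n) n a b i j + mode_trajectory (par_h n) n a b j i)"
proof -
  have CB: "(\<Sum>k<Suc n. C_mat n $$ (i, k) * (if j < k then par_h n else if j = k then 1 else 0))
    = mode_combination n (\<lambda>a b. mode_trajectory (par_h n) n a b i j)" if "i \<le> n" for i j
  proof -
    have "(\<Sum>k<Suc n. C_mat n $$ (i, k) * (if j < k then par_h n else if j = k then 1 else 0))
      = (\<Sum>k<Suc n. mode_combination n (\<lambda>a b. mode_entry (par_h n) a b i k)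
          * (if j < k then par_h n else if j = k then 1 else 0))"
      using that by (intro sum.cong) (auto simp: C_mat_entry)
    also have "\<dots> = mode_combination n (\<lambda>a b. mode_trajectory (par_h n) n a b i j)"
      unfolding mode_trajectory_def by (rule mode_combination_sum)
    finally show ?thesis .
  qed
  have "H_mat n $$ (i, j) =
      (\<Sum>k<Suc n. C_mat n $$ (i, k) * (if j < k then par_h n else if j = k then 1 else 0))
      + (\<Sum>k<Suc n. C_mat n $$ (j, k) * (if i < k then par_h n else if i = k then 1 else 0))"
    using assms
    by (auto simp: H_mat_def C_mat_def trajectory_mat_def scalar_prod_def atLeast0LessThan
        simp del: sum.lessThan_Suc intro!: arg_cong2[where f = "(+)"] sum.cong)
  then show ?thesis
    unfolding CB[OF assms(1)] CB[OF assms(2)] mode_combination_add .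
qed

text \<open>Setting \<open>q\<^sub>n\<^sub>-\<^sub>1 = 0\<close> makes the defining relation of the \<open>q\<^sub>i\<close> also express that of \<open>p\<^sub>n\<^sub>-\<^sub>1\<close>.\<close>

definition adjacent_ext :: "nat \<Rightarrow> nat \<Rightarrow> real" where
  "adjacent_ext n i = (if Suc i < n then adjacent_weight n i else 0)"

text \<open>Index i meets the suffix intervals with a \<le> i, and the adjacent ones [i,i+1] at
  position (0,1) and [i-1,i] at position (1,0).\<close>

lemma mode_combination_local:
  assumes "i < n"
  shows "mode_combination n (\<lambda>a b. if a \<le> i \<and> i \<le> b then f (real i - real a) (real b - real i) else 0)
    = (\<Sum>a\<le>i. suffix_weight n a * f (real i - real a) (real n - real i))
      + adjacent_ext n i * f 0 1 + (if i = 0 then 0 else adjacent_ext n (i - 1) * f 1 0)"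
proof -
  have "(\<Sum>a<n. suffix_weight n a * (if a \<le> i \<and> i \<le> n then f (real i - real a) (real n - real i) else 0))
    = (\<Sum>a\<le>i. suffix_weight n a * f (real i - real a) (real n - real i))"
    using assms by (intro sum.mono_neutral_cong_right) auto
  \<comment> \<open>For i = 0 the truncated i - 1 is 0 as well; the inner conditional removes this
    spurious term.\<close>
  moreover have "(\<Sum>k<n - 1. adjacent_weight n k *
      (if k \<le> i \<and> i \<le> k + 1 then f (real i - real k) (real (k + 1) - real i) else 0))
    = (\<Sum>k<n - 1. (if k = i then adjacent_weight n i * f 0 1 else 0)
        + (if k = i - 1 then (if i = 0 then 0 else adjacent_weight n (i - 1) * f 1 0) else 0))"
  proof (rule sum.cong)
    fix k
    consider "k = i" "i = 0" | "k = i" "i > 0" | "i = Suc k" | "\<not> (k \<le> i \<and> i \<le> k + 1)" by linarith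
    then show "adjacent_weight n k *
        (if k \<le> i \<and> i \<le> k + 1 then f (real i - real k) (real (k + 1) - real i) else 0)
      = (if k = i then adjacent_weight n i * f 0 1 else 0)
        + (if k = i - 1 then (if i = 0 then 0 else adjacent_weight n (i - 1) * f 1 0) else 0)"
      by cases auto
  qed simp
  ultimately show ?thesis
    using assms unfolding mode_combination_def
    by (auto simp: sum.distrib adjacent_ext_def)
qed

lemma mode_combination_last:
  "mode_combination n (\<lambda>a b. if a \<le> n \<and> n \<le> b then f (real n - real a) (real b - real n) else 0)
    = (\<Sum>a<n. suffix_weight n a * f (real n - real a) 0)"
proof -
  have "(\<Sum>k<n - 1. adjacent_weight n k * (if k \<le> n \<and> n \<le> k + 1
      then f (real n - real k) (real (k + 1) - real n) else 0)) = 0"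
    by (intro sum.neutral) auto
  then show ?thesis unfolding mode_combination_def by (simp add: less_imp_le)
qed

text \<open>The term a = i has first argument -1 and drops out, which leaves the same sum one index
  lower.\<close>

lemma sum_weights_shift:
  fixes g :: "real \<Rightarrow> real \<Rightarrow> real"
  assumes "\<And>t. g (-1) t = 0"
  shows "(\<Sum>a\<le>i. suffix_weight n a * g (real i - real a - 1) (real n - real i + 1))
    = (if i = 0 then 0 else
        (\<Sum>a\<le>i - 1. suffix_weight n a * g (real (i - 1) - real a) (real n - real (i - 1))))"
  using assms by (cases i) (simp_all add: algebra_simps)

section \<open>Elimination of the adjacent weights\<close>

text \<open>The column sums of the suffix part of C, accumulated over columns 0 to i.\<close>

definition flux :: "nat \<Rightarrow> nat \<Rightarrow> real" where
  "flux n i = (\<Sum>a\<le>i. suffix_weight n a * mode_flux (par_h n) (real i - real a) (real n - real i))"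

lemma sigma_fun_eq: "sigma_fun n s t = mode_flux (par_h n) (real s) (real t)"
  by (simp add: sigma_fun_def mode_flux_def par_alpha_h)

lemma adjacent_ext:
  assumes "i < n"
  shows "par_alpha n * adjacent_ext n i = real i + 1 - flux n i"
proof -
  have \<alpha>: "par_alpha n \<noteq> 0" using par_r[of n] assms by (simp add: par_alpha_def)
  show ?thesis
  proof (cases "Suc i < n")
    case True
    have "flux n i = (\<Sum>a\<le>i. suffix_weight n a * sigma_fun n (i - a) (n - i))"
      unfolding flux_def sigma_fun_eq using assms by (intro sum.cong) auto
    then show ?thesis using True \<alpha> by (simp add: adjacent_ext_def adjacent_weight_def)
  next
    case False
    then have n: "n = Suc i" using assms by simp
    \<comment> \<open>The formula for p_(n-1) is the equation flux = n, solved for its last term,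
      whose coefficient is \<sigma>(0,1) = \<alpha>.\<close>
    have "flux n i = (\<Sum>a<i. suffix_weight n a * mode_flux (par_h n) (real i - real a) (real n - real i))
        + suffix_weight n i * par_alpha n"
      unfolding flux_def lessThan_Suc_atMost[symmetric]
      by (simp add: n mode_flux_def par_alpha_h)
    also have "suffix_weight n i * par_alpha n = real n - (\<Sum>a<i. suffix_rec n a * (real n - real a) *
           (par_alpha n - par_h n / 2 * (real n - 1 - real a)))"
      using n \<alpha> by (simp add: suffix_weight_def)
    also have "(\<Sum>a<i. suffix_rec n a * (real n - real a) *
           (par_alpha n - par_h n / 2 * (real n - 1 - real a)))
      = (\<Sum>a<i. suffix_weight n a * mode_flux (par_h n) (real i - real a) (real n - real i))"
      by (intro sum.cong) (auto simp: suffix_weight_def n mode_flux_def par_alpha_h field_simps)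
    finally show ?thesis using n by (simp add: adjacent_ext_def)
  qed
qed

section \<open>Row and column sums of C\<close>

lemma C_mat_row_sum:
  assumes "i \<le> n"
  shows "(\<Sum>j<Suc n. C_mat n $$ (i, j)) = 0"
proof -
  have "(\<Sum>j<Suc n. C_mat n $$ (i, j))
    = (\<Sum>j<Suc n. mode_combination n (\<lambda>a b. mode_entry (par_h n) a b i j) * 1)"
    using assms by (intro sum.cong) (auto simp: C_mat_entry)
  also have "\<dots> = mode_combination n (\<lambda>a b. \<Sum>j<Suc n. mode_entry (par_h n) a b i j * 1)"
    by (rule mode_combination_sum)
  also have "\<dots> = mode_combination n (\<lambda>a b. 0)"
    by (rule mode_combination_cong) (simp add: mode_row_partial_sum del: sum.lessThan_Suc)
  finally show ?thesis by (simp add: mode_combination_def)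
qed

text \<open>By \<open>adjacent_ext\<close> the first j + 1 columns sum to flux + \<alpha> q_j = j +
  1. Differencing gives 1 for j < n, and the last column receives minus the flux at n - 1, which is
  n.\<close>

lemma C_mat_col_sum:
  assumes "j \<le> n" "n \<ge> 1"
  shows "(\<Sum>i<Suc n. C_mat n $$ (i, j)) = (if j < n then 1 else - real n)"
proof -
  define f where "f s t = mode_flux (par_h n) s t - mode_flux (par_h n) (s - 1) (t + 1)" for s t
  have "(\<Sum>i<Suc n. C_mat n $$ (i, j))
    = (\<Sum>i<Suc n. mode_combination n (\<lambda>a b. mode_entry (par_h n) a b i j) * 1)"
    using assms by (intro sum.cong) (auto simp: C_mat_entry)
  also have "\<dots> = mode_combination n (\<lambda>a b. \<Sum>i<Suc n. mode_entry (par_h n) a b i j * 1)"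
    by (rule mode_combination_sum)
  also have "\<dots> = mode_combination n
      (\<lambda>a b. if a \<le> j \<and> j \<le> b then f (real j - real a) (real b - real j) else 0)"
  proof (rule mode_combination_cong)
    fix a b assume ab: "a < b" "b \<le> n"
    show "(\<Sum>i<Suc n. mode_entry (par_h n) a b i j * 1)
      = (if a \<le> j \<and> j \<le> b then f (real j - real a) (real b - real j) else 0)"
    proof (cases "a \<le> j \<and> j \<le> b")
      case True
      then show ?thesis using ab
        by (simp add: mode_column_partial_sum f_def del: sum.lessThan_Suc)
    next
      case False
      then show ?thesis by (auto simp: mode_entry_def intro!: sum.neutral)
    qed
  qed
  finally have *: "(\<Sum>i<Suc n. C_mat n $$ (i, j)) = \<dots>" .
  show ?thesis
  proof (cases "j < n")
    case True
    have f01: "f 0 1 = par_alpha n" "f 1 0 = - par_alpha n"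
      by (simp_all add: f_def mode_flux_def par_alpha_h)
    have "(\<Sum>a\<le>j. suffix_weight n a * f (real j - real a) (real n - real j))
      = flux n j - (if j = 0 then 0 else flux n (j - 1))"
      unfolding f_def right_diff_distrib sum_subtractf flux_def
      by (subst sum_weights_shift) (simp_all add: mode_flux_def)
    then show ?thesis
      unfolding * mode_combination_local[OF True] f01
      using True adjacent_ext[OF True] adjacent_ext[of "j - 1" n]
      by (cases j) (auto simp: algebra_simps)
  next
    case False
    then have j: "j = n" using assms by simp
    have "(\<Sum>a<n. suffix_weight n a * f (real n - real a) 0) = - flux n (n - 1)"
      using assms(2) unfolding flux_def sum_negf[symmetric]
      by (intro sum.cong) (auto simp: f_def mode_flux_def)
    then show ?thesis
      using adjacent_ext[of "n - 1" n] assms(2)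
      unfolding * unfolding j mode_combination_last by (simp add: adjacent_ext_def)
  qed
qed

section \<open>The diagonal of H\<close>

text \<open>With \<alpha> = 2 - h and r = h - 1, the flux terms are what eliminating q_i and q_(i-1)
  adds to the energy, and the result involves the kernel F alone.\<close>

lemma energy_identity:
  fixes h :: real
  shows "2 * (2 - h) * mode_energy h s t - 2 * (h - 1)\<^sup>2 * mode_flux h s t + 2 * mode_flux h (s - 1) (t + 1)
    = h * moment_kernel (s - 1) (t + 1) - h * (h - 1)\<^sup>2 * moment_kernel s t"
  unfolding mode_energy_def mode_flux_def moment_kernel_def
  by (simp add: field_simps power2_eq_square)

lemma H_mat_diag_energy:
  assumes "i \<le> n"
  shows "H_mat n $$ (i, i) = 2 * mode_combination n (\<lambda>a b.
    if a \<le> i \<and> i \<le> b then mode_energy (par_h n) (real i - real a) (real b - real i) else 0)"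
proof -
  have "H_mat n $$ (i, i) = mode_combination n (\<lambda>a b.
    (if a \<le> i \<and> i \<le> b then mode_energy (par_h n) (real i - real a) (real b - real i) else 0)
    + (if a \<le> i \<and> i \<le> b then mode_energy (par_h n) (real i - real a) (real b - real i) else 0))"
    unfolding H_mat_entry[OF assms assms]
    using assms by (intro mode_combination_cong) (simp add: mode_trajectory_diag)
  then show ?thesis unfolding mode_combination_add[symmetric] by simp
qed

lemma H_mat_diag:
  assumes "i < n"
  shows "H_mat n $$ (i, i) = par_alpha n"
proof -
  let ?h = "par_h n" and ?\<alpha> = "par_alpha n" and ?r = "par_r n"
  define q where "q = (if i = 0 then 0 else adjacent_ext n (i - 1))"
  define P where "P = (if i = 0 then 0 else flux n (i - 1))"
  define M where "M = (if i = 0 then 0 else moment n (suffix_weight n) (i - 1))"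
  define D where "D = (\<Sum>a\<le>i. suffix_weight n a * mode_energy ?h (real i - real a) (real n - real i))"
  have \<alpha>: "?\<alpha> \<noteq> 0" using par_r[of n] assms by (simp add: par_alpha_def)
  have hr: "?h - 1 = ?r" by (simp add: par_h_def)
  \<comment> \<open>These are the coefficients with which q_i and q_(i-1) enter half the diagonal
    entry.\<close>
  have e: "mode_energy ?h 0 1 = ?r\<^sup>2" "mode_energy ?h 1 0 = - 1"
    by (simp_all add: mode_energy_def par_h_def power2_eq_square)
  have H: "H_mat n $$ (i, i) = 2 * (D + adjacent_ext n i * ?r\<^sup>2 - q)"
    using assms
    by (simp add: H_mat_diag_energy mode_combination_local[OF assms] e q_def D_def)
  have q: "?\<alpha> * q = real i - P"
    using adjacent_ext[of "i - 1" n] assms by (auto simp: q_def P_def)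
  have P: "P = (\<Sum>a\<le>i. suffix_weight n a * mode_flux ?h (real i - real a - 1) (real n - real i + 1))"
    unfolding P_def flux_def by (subst sum_weights_shift) (simp_all add: mode_flux_def)
  have M: "M = (\<Sum>a\<le>i. suffix_weight n a * moment_kernel (real i - real a - 1) (real n - real i + 1))"
    unfolding M_def moment_def by (subst sum_weights_shift) (simp_all add: moment_kernel_def)
  have "2 * ?\<alpha> * D - 2 * ?r\<^sup>2 * flux n i + 2 * P
    = (\<Sum>a\<le>i. suffix_weight n a * (2 * ?\<alpha> * mode_energy ?h (real i - real a) (real n - real i)
        - 2 * ?r\<^sup>2 * mode_flux ?h (real i - real a) (real n - real i)
        + 2 * mode_flux ?h (real i - real a - 1) (real n - real i + 1)))"
    unfolding D_def flux_def P sum_distrib_left sum.distrib[symmetric] sum_subtractf[symmetric]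
    by (intro sum.cong) (simp_all add: algebra_simps)
  also have "\<dots> = ?h * M - ?h * ?r\<^sup>2 * moment n (suffix_weight n) i"
    unfolding energy_identity[of ?h, unfolded hr par_alpha_h[symmetric]] M moment_def sum_distrib_left sum_subtractf[symmetric]
    by (intro sum.cong) (simp_all add: algebra_simps)
  also have "\<dots> = ?\<alpha>\<^sup>2 + 2 * real i - 2 * ?r\<^sup>2 * (real i + 1)"
    using Z_seq_recurrence[of n i] assms by (simp add: M_def moment_suffix_weight cong: if_cong)
  finally have D: "2 * ?\<alpha> * D = ?\<alpha>\<^sup>2 + 2 * (real i - P) - 2 * ?r\<^sup>2 * (real i + 1 - flux n i)"
    by (simp add: algebra_simps)
  have "?\<alpha> * (H_mat n $$ (i, i)) = ?\<alpha> * ?\<alpha>"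
    unfolding H using D unfolding q[symmetric] adjacent_ext[OF assms, symmetric]
    by (simp add: algebra_simps power2_eq_square)
  then show ?thesis using \<alpha> by simp
qed

text \<open>At the corner t = 0 and the energy is -s, so the entry is -2 \<open>S\<close>. At t = 1
  the flux splits into \<alpha> \<open>S\<close> and a multiple of the last moment, both flux and
  moment being known there.\<close>

lemma H_mat_corner:
  assumes "n \<ge> 1"
  shows "H_mat n $$ (n, n) = - real n * (1 + par_R n)"
proof -
  let ?h = "par_h n" and ?\<alpha> = "par_alpha n" and ?R = "par_R n"
  define S where "S = (\<Sum>a\<le>n - 1. suffix_weight n a * (real n - real a))"
  have \<alpha>: "?\<alpha> \<noteq> 0" and h: "?h \<noteq> 0"
    using par_r[OF assms] by (auto simp: par_alpha_def par_h_def)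
  have "{..<n} = {..n - 1}" using assms by auto
  then have H: "H_mat n $$ (n, n) = - 2 * S"
    unfolding H_mat_diag_energy[OF order_refl] mode_combination_last S_def
    by (simp add: mode_energy_def sum_distrib_left sum_negf[symmetric] algebra_simps)
  have "flux n (n - 1) = ?\<alpha> * S + ?h / 2 * moment n (suffix_weight n) (n - 1)"
    unfolding S_def flux_def moment_def sum_distrib_left sum.distrib[symmetric] using assms
    by (intro sum.cong) (simp_all add: par_alpha_h mode_flux_def moment_kernel_def field_simps)
  then have S: "?\<alpha> * S = real n - ?h / 2 * Z_seq n (n - 1)"
    using adjacent_ext[of "n - 1" n] assms
    by (simp add: adjacent_ext_def moment_suffix_weight)
  have "?h * Z_seq n (n - 1) * ?h = 2 * ?h * (real n - 1) + 3 + par_r n - ?\<alpha> * ?R\<^sup>2"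
    using assms h by (simp add: Z_seq_eq inverse_square_power power2_eq_square[of ?h] del: power_Suc)
  \<comment> \<open>Writing R^2 = 1 + n h (1 + R) exposes the factor h.\<close>
  then have "?h * (?h * Z_seq n (n - 1)) = ?h * (2 * real n - ?\<alpha> * real n * (1 + ?R))"
    by (simp add: par_R_def par_alpha_def par_h_def algebra_simps power2_eq_square)
  then have Z: "?h * Z_seq n (n - 1) = 2 * real n - ?\<alpha> * real n * (1 + ?R)"
    using h by simp
  have "?\<alpha> * (H_mat n $$ (n, n)) = ?\<alpha> * (- real n * (1 + ?R))"
    unfolding H using S Z by (simp add: algebra_simps)
  then show ?thesis using \<alpha> mult_left_cancel by blast
qed

section \<open>Off-diagonal entries of H and conclusion\<close>

lemma H_mat_off_diag:
  assumes "i \<le> n" "j \<le> n" "i \<noteq> j"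
  shows "H_mat n $$ (i, j) = 0"
proof -
  have "H_mat n $$ (i, j) = mode_combination n (\<lambda>a b. 0)"
    unfolding H_mat_entry[OF assms(1,2)]
    using assms by (intro mode_combination_cong mode_trajectory_antisym) auto
  then show ?thesis by (simp add: mode_combination_def)
qed

theorem lemma3p2:
  fixes n :: nat
  assumes "n \<ge> 1"
  shows "row_sums (C_mat n) = 0\<^sub>v (n + 1)
    \<and> col_sums (C_mat n) = b_vec n
    \<and> diagonal_mat (H_mat n)
    \<and> (\<forall>i<n. H_mat n $$ (i, i) = par_alpha n)
    \<and> H_mat n $$ (n, n) = - real n * (1 + par_R n)"
proof (intro conjI allI impI)
  have dim: "dim_row (C_mat n) = Suc n" "dim_col (C_mat n) = Suc n"
    by (simp_all add: C_mat_def)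
  have dimH: "dim_row (H_mat n) = Suc n" "dim_col (H_mat n) = Suc n"
    by (simp_all add: H_mat_def C_mat_def trajectory_mat_def)
  show "row_sums (C_mat n) = 0\<^sub>v (n + 1)"
    by (rule eq_vecI) (simp_all add: row_sums_def dim C_mat_row_sum del: sum.lessThan_Suc)
  show "col_sums (C_mat n) = b_vec n"
    using assms by (intro eq_vecI) (simp_all add: col_sums_def b_vec_def dim C_mat_col_sum del: sum.lessThan_Suc)
  show "diagonal_mat (H_mat n)"
    unfolding diagonal_mat_def dimH by (simp add: H_mat_off_diag)
  show "H_mat n $$ (i, i) = par_alpha n" if "i < n" for i
    using that by (rule H_mat_diag)
  show "H_mat n $$ (n, n) = - real n * (1 + par_R n)"
    using assms by (rule H_mat_corner)
qed

end
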